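(* For all integers $n,q\ge 2$, $$(n/q)^{q-1}\le f(q,n)\le (n-1)^{q-1}+1.$$
   Context: $D_N$ is the complete digraph on $N$ vertices (each pair of distinct vertices joined by two oppositely directed edges, no loops). A walk of length $n$ is a sequence of $n$ vertices $v_1,\dots,v_n$ (repetitions allowed) with each $\overrightarrow{v_iv_{i+1}}$ an edge; it is monochromatic if all these edges have the same color. $f(q,n)$ is the smallest $N$ such that every coloring of the edges of $D_N$ with $q$ colors contains a monochromatic walk of length $n$. *)

theory Defs
  imports Complex_Main "HOL-Library.FuncSet" "Graph_Theory.Graph_Theory"
begin

definition complete_dg :: "nat \<Rightarrow> nat pair_pre_digraph" where
  "complete_dg N = \<lparr> pverts = {..<N}, parcs = {(u, v). u < N \<and> v < N \<and> u \<noteq> v} \<rparr>"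

lemma complete_digraph_complete_dg: "complete_digraph N (with_proj (complete_dg N))"
proof -
  interpret pair_graph "complete_dg N"
    by unfold_locales
      (auto simp: complete_dg_def symmetric_def sym_def intro: finite_subset[of _ "{..<N} \<times> {..<N}"])
  show ?thesis
    by (auto simp: complete_digraph_def complete_dg_def[of N] intro: graph_axioms[unfolded complete_dg_def])
qed

definition edge_coloring :: "nat \<Rightarrow> nat \<Rightarrow> (nat \<times> nat \<Rightarrow> nat) \<Rightarrow> bool" where
  "edge_coloring q N c \<longleftrightarrow> c \<in> parcs (complete_dg N) \<rightarrow> {..<q}"

definition monochromatic :: "('a \<times> 'a \<Rightarrow> 'b) \<Rightarrow> 'a vwalk \<Rightarrow> bool" where
  "monochromatic c p \<longleftrightarrow> (\<exists>i. \<forall>e \<in> set (vwalk_arcs p). c e = i)"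

text \<open>The length of a walk is its number of vertices, \<^term>\<open>length p\<close>; note that
  \<^const>\<open>vwalk_length\<close> counts arcs instead.\<close>

definition forces_mono_walk :: "nat \<Rightarrow> nat \<Rightarrow> nat \<Rightarrow> bool" where
  "forces_mono_walk q n N \<longleftrightarrow>
     (\<forall>c. edge_coloring q N c \<longrightarrow>
        (\<exists>p. vwalk p (with_proj (complete_dg N)) \<and> length p = n \<and> monochromatic c p))"

definition walk_ramsey :: "nat \<Rightarrow> nat \<Rightarrow> nat" where
  "walk_ramsey q n = (LEAST N. forces_mono_walk q n N)"

end

theory Submission
  imports Defs
begin

text \<open>
  A color class without a walk of length n carries a height function with values in \<open>{0..<n-1}\<close>
  that is strictly monotone along its edges, and conversely such a function excludes a walk of
  length n.

  Upper bound: record the heights of every vertex for all colors but the last. If there are more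
  than \<open>(n-1)^(q-1)\<close> vertices, two of them agree in all heights, so both edges between them have the
  last color, and walking back and forth between them gives a monochromatic walk of any length.

  Lower bound: take as vertices distinct vectors in \<open>{0..<k}^(q-1)\<close> with \<open>(q-1)(k-1) \<le> n-2\<close>.
  Color an edge by a coordinate that increases along it, and by the last color if there is none,
  in which case the coordinate sum decreases.
\<close>

lemma complete_dg_simps [simp]:
  "pverts (complete_dg N) = {..<N}"
  "parcs (complete_dg N) = {(u, v). u < N \<and> v < N \<and> u \<noteq> v}"
  by (simp_all add: complete_dg_def)

lemma edge_coloring_iff:
  "edge_coloring q N c \<longleftrightarrow> (\<forall>u<N. \<forall>v<N. u \<noteq> v \<longrightarrow> c (u, v) < q)"
  by (auto simp: edge_coloring_def complete_dg_def Pi_def)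

lemma vwalk_take:
  assumes "vwalk p G" "m > 0"
  shows "vwalk (take m p) G" "set (vwalk_arcs (take m p)) \<subseteq> set (vwalk_arcs p)"
proof -
  show *: "set (vwalk_arcs (take m p)) \<subseteq> set (vwalk_arcs p)"
    using set_vwalk_arcs_append1[of "take m p" "drop m p"] by simp
  show "vwalk (take m p) G"
    using assms * set_take_subset[of m p] by (fastforce simp: vwalk_def)
qed

text \<open>Each arc raises the height by at least 1, and a walk with \<open>length p\<close>
  vertices has one arc fewer. So heights bounded by M exclude walks on more than M + 1
  vertices.\<close>

lemma length_le_height_diff:
  fixes h :: "'a \<Rightarrow> nat"
  assumes "p \<noteq> []" "\<forall>(u, v) \<in> set (vwalk_arcs p). h u < h v"
  shows "h (hd p) + length p \<le> Suc (h (last p))"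
  using assms by (induction p rule: vwalk_arcs.induct) auto

text \<open>The height of v is the number of arcs of a longest walk of color i starting at v.
  Prepending u along an edge of color i from u to v gives a longer such walk from u.\<close>

lemma color_class_height:
  fixes G :: "('a, 'b) pre_digraph"
  assumes no_walk: "\<nexists>p. vwalk p G \<and> length p = n \<and> (\<forall>e \<in> set (vwalk_arcs p). c e = i)"
    and "n > 0"
  obtains h :: "'a \<Rightarrow> nat" where
    "\<And>v. v \<in> verts G \<Longrightarrow> h v < n - 1"
    "\<And>u v. (u, v) \<in> arcs_ends G \<Longrightarrow> u \<in> verts G \<Longrightarrow> v \<in> verts G \<Longrightarrow> c (u, v) = i \<Longrightarrow> h v < h u"
proof -
  define walks where
    "walks v = {p. vwalk p G \<and> hd p = v \<and> (\<forall>e \<in> set (vwalk_arcs p). c e = i)}" for v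
  define h where "h v = Max ((\<lambda>p. length p - 1) ` walks v)" for v
  \<comment> \<open>Only walks of length exactly n are excluded, but a longer one could be cut down
    to its first n vertices. Hence the set under \<open>Max\<close> is finite.\<close>
  have short: "length p < n" if "p \<in> walks v" for p v
  proof (rule ccontr)
    assume "\<not> length p < n"
    then have "length (take n p) = n" by simp
    moreover have "vwalk (take n p) G" "\<forall>e \<in> set (vwalk_arcs (take n p)). c e = i"
      using that vwalk_take[of p G n] \<open>n > 0\<close> by (auto simp: walks_def)
    ultimately show False using no_walk by blast
  qed
  have short': "length p - 1 < n - 1" if "p \<in> walks v" for p v
    using short[OF that] that by (cases p) (auto simp: walks_def vwalk_def)
  have fin: "finite ((\<lambda>p. length p - 1) ` walks v)" for v
    by (rule finite_subset[of _ "{..<n - 1}"]) (auto dest: short')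
  have trivial: "[v] \<in> walks v" if "v \<in> verts G" for v
    using that by (auto simp: walks_def vwalk_def)
  have attained: "\<exists>p \<in> walks v. h v = length p - 1" if "v \<in> verts G" for v
    using Max_in[OF fin[of v]] trivial[OF that] unfolding h_def by blast
  show ?thesis
  proof
    show "h v < n - 1" if "v \<in> verts G" for v
      using attained[OF that] short' by auto
  next
    fix u v
    assume uv: "(u, v) \<in> arcs_ends G" "u \<in> verts G" "v \<in> verts G" "c (u, v) = i"
    obtain p where p: "p \<in> walks v" "h v = length p - 1"
      using attained uv by blast
    have ne: "p \<noteq> []" using p by (auto simp: walks_def vwalk_def)
    have "u # p \<in> walks u"
      using p uv ne by (auto simp: walks_def intro: vwalk_consI)
    then have "length (u # p) - 1 \<le> h u"
      unfolding h_def using fin by (intro Max_ge) blast+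
    with p ne show "h v < h u" by (cases p) auto
  qed
qed

text \<open>Knowing that the walk starts in u or v lets the induction prepend the other
  vertex.\<close>

lemma back_and_forth_walk:
  assumes "u \<in> verts G" "v \<in> verts G" "(u, v) \<in> arcs_ends G" "(v, u) \<in> arcs_ends G"
  shows "\<exists>p. vwalk p G \<and> length p = Suc m \<and> hd p \<in> {u, v} \<and> set (vwalk_arcs p) \<subseteq> {(u, v), (v, u)}"
proof (induction m)
  case 0
  show ?case using assms by (intro exI[of _ "[u]"]) (auto simp: vwalk_def)
next
  case (Suc m)
  then obtain p where p: "vwalk p G" "length p = Suc m" "hd p \<in> {u, v}"
      "set (vwalk_arcs p) \<subseteq> {(u, v), (v, u)}"
    by blast
  define x where "x = (if hd p = u then v else u)"
  have "p \<noteq> []" using p by auto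
  then show ?case
    using p assms by (intro exI[of _ "x # p"]) (auto simp: x_def intro: vwalk_consI)
qed

lemma forces_mono_walk_power:
  assumes "n > 0" "q > 0"
  shows "forces_mono_walk q n ((n - 1) ^ (q - 1) + 1)"
  unfolding forces_mono_walk_def
proof (intro allI impI, rule ccontr)
  define N where "N = (n - 1) ^ (q - 1) + 1"
  let ?G = "with_proj (complete_dg N)"
  fix c
  assume "edge_coloring q ((n - 1) ^ (q - 1) + 1) c"
  then have col: "c (u, v) < q" if "u < N" "v < N" "u \<noteq> v" for u v
    using that by (simp add: edge_coloring_iff N_def)
  assume "\<nexists>p. vwalk p (with_proj (complete_dg ((n - 1) ^ (q - 1) + 1)))
              \<and> length p = n \<and> monochromatic c p"
  then have no_walk: "\<nexists>p. vwalk p ?G \<and> length p = n \<and> (\<forall>e \<in> set (vwalk_arcs p). c e = i)" for i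
    unfolding monochromatic_def N_def by blast
  have "\<exists>h :: nat \<Rightarrow> nat. (\<forall>v<N. h v < n - 1) \<and>
      (\<forall>u<N. \<forall>v<N. u \<noteq> v \<longrightarrow> c (u, v) = i \<longrightarrow> h v < h u)" for i
    by (rule color_class_height[OF no_walk[of i] \<open>n > 0\<close>]) auto
  then obtain H :: "nat \<Rightarrow> nat \<Rightarrow> nat" where H: "\<And>i v. v < N \<Longrightarrow> H i v < n - 1"
      "\<And>i u v. u < N \<Longrightarrow> v < N \<Longrightarrow> u \<noteq> v \<Longrightarrow> c (u, v) = i \<Longrightarrow> H i v < H i u"
    by metis
  \<comment> \<open>The restriction makes \<open>F v\<close> extensional, so that it lies in a
    function space of size (n - 1)^(q - 1).\<close>
  define F where "F v = (\<lambda>i \<in> {..<q - 1}. H i v)" for v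
  have "F ` {..<N} \<subseteq> {..<q - 1} \<rightarrow>\<^sub>E {..<n - 1}"
    using H(1) by (auto simp: F_def split: if_splits)
  then have "card (F ` {..<N}) \<le> (n - 1) ^ (q - 1)"
    using card_mono[of "{..<q - 1} \<rightarrow>\<^sub>E {..<n - 1}" "F ` {..<N}"]
    by (simp add: card_funcsetE finite_PiE)
  then have "card (F ` {..<N}) < card {..<N}" by (simp add: N_def)
  then have "\<not> inj_on F {..<N}" by (rule pigeonhole)
  then obtain u v where uv: "u < N" "v < N" "u \<noteq> v" "F u = F v"
    by (auto simp: inj_on_def)
  have eq: "H i u = H i v" if "i < q - 1" for i
    using fun_cong[OF uv(4), of i] that by (simp add: F_def)
  \<comment> \<open>Any other color would force u and v to differ in the height for that
    color.\<close>
  have "c (u, v) = q - 1"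
  proof (rule ccontr)
    assume "c (u, v) \<noteq> q - 1"
    then have "c (u, v) < q - 1" using col[OF uv(1-3)] by linarith
    then show False using eq H(2)[OF uv(1-3) refl] by simp
  qed
  moreover have "c (v, u) = q - 1"
  proof (rule ccontr)
    assume "c (v, u) \<noteq> q - 1"
    then have "c (v, u) < q - 1" using col[OF uv(2,1)] uv(3) by linarith
    then show False using eq H(2)[OF uv(2,1) _ refl] uv(3) by simp
  qed
  moreover obtain p where "vwalk p ?G" "length p = n" "set (vwalk_arcs p) \<subseteq> {(u, v), (v, u)}"
    using back_and_forth_walk[of u ?G v "n - 1"] uv \<open>n > 0\<close> by auto
  ultimately have "vwalk p ?G \<and> length p = n \<and> (\<forall>e \<in> set (vwalk_arcs p). c e = q - 1)"
    by auto
  with no_walk show False by blast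
qed

lemma not_forces_mono_walk:
  assumes "N \<le> k ^ (q - 1)" "(q - 1) * (k - 1) + 2 \<le> n" "q > 0"
  shows "\<not> forces_mono_walk q n N"
proof
  assume forces: "forces_mono_walk q n N"
  have "card {..<N} \<le> card ({..<q - 1} \<rightarrow>\<^sub>E {..<k})"
    using assms by (simp add: card_funcsetE)
  then obtain f :: "nat \<Rightarrow> nat \<Rightarrow> nat" where
    f: "f ` {..<N} \<subseteq> {..<q - 1} \<rightarrow>\<^sub>E {..<k}" "inj_on f {..<N}"
    using card_le_inj[of "{..<N}" "{..<q - 1} \<rightarrow>\<^sub>E {..<k}"] by (auto simp: finite_PiE)
  have fk: "f v i \<le> k - 1" if "v < N" "i < q - 1" for v i
  proof -
    have "f v \<in> {..<q - 1} \<rightarrow>\<^sub>E {..<k}" using f(1) that by auto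
    then have "f v i \<in> {..<k}" using that by (auto simp: PiE_iff)
    then show ?thesis by auto
  qed
  define s where "s v = (\<Sum>i<q - 1. f v i)" for v
  have s_le: "s v \<le> (q - 1) * (k - 1)" if "v < N" for v
    using sum_bounded_above[of "{..<q - 1}" "f v" "k - 1"] fk that by (simp add: s_def)
  define up where "up u v i \<longleftrightarrow> i < q - 1 \<and> f u i < f v i" for u v i
  define c where "c = (\<lambda>(u, v). if \<exists>i. up u v i then SOME i. up u v i else q - 1)"
  \<comment> \<open>The coordinate sum is reflected so that it too increases along its edges. By
    \<open>s_le\<close> the subtraction never truncates.\<close>
  define h where "h i v = (if i < q - 1 then f v i else (q - 1) * (k - 1) - s v)" for i v
  have c_up: "up u v (c (u, v))" if "\<exists>i. up u v i" for u v
    using someI_ex[OF that] that by (simp add: c_def)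
  have "c (u, v) < q" for u v
  proof (cases "\<exists>i. up u v i")
    case True
    then have "c (u, v) < q - 1" using c_up by (simp add: up_def)
    then show ?thesis by linarith
  next
    case False
    then show ?thesis using \<open>q > 0\<close> by (auto simp: c_def)
  qed
  then have "edge_coloring q N c" by (simp add: edge_coloring_iff)
  then obtain p i where p: "vwalk p (with_proj (complete_dg N))" "length p = n"
      "\<forall>e \<in> set (vwalk_arcs p). c e = i"
    using forces unfolding forces_mono_walk_def monochromatic_def by blast
  have h_less: "h (c (u, v)) u < h (c (u, v)) v" if uv: "u < N" "v < N" "u \<noteq> v" for u v
  proof (cases "\<exists>i. up u v i")
    case True
    then show ?thesis using c_up[OF True] by (simp add: up_def h_def)
  next
    case False
    then have le: "f v i \<le> f u i" if "i < q - 1" for i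
      using that unfolding up_def by (meson not_less)
    have "f u \<noteq> f v" using f(2) uv by (auto simp: inj_on_def)
    moreover have "f u \<in> {..<q - 1} \<rightarrow>\<^sub>E {..<k}" "f v \<in> {..<q - 1} \<rightarrow>\<^sub>E {..<k}"
      using f(1) uv by auto
    ultimately obtain j where "j < q - 1" "f u j \<noteq> f v j"
      by (metis PiE_ext lessThan_iff)
    \<comment> \<open>No coordinate increases from u to v, and coordinate j differs, so it strictly
      decreases.\<close>
    then have "s v < s u"
      unfolding s_def using le by (intro sum_strict_mono_ex1) (auto intro!: bexI[of _ j] simp: less_le)
    then show ?thesis
      using s_le[OF uv(1)] False by (auto simp: h_def c_def)
  qed
  have "\<forall>(u, v) \<in> set (vwalk_arcs p). h i u < h i v"
    using p h_less by (fastforce simp: vwalk_def)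
  then have "h i (hd p) + n \<le> Suc (h i (last p))"
    using length_le_height_diff[of p "h i"] p by (auto simp: vwalk_def)
  moreover have "h i (last p) \<le> (q - 1) * (k - 1)"
  proof (cases "i < q - 1")
    case True
    have "last p < N" using p(1) last_in_set unfolding vwalk_def by fastforce
    then have "h i (last p) \<le> 1 * (k - 1)" using fk True by (simp add: h_def)
    \<comment> \<open>Having some i < q - 1 gives q - 1 \<ge> 1.\<close>
    also have "\<dots> \<le> (q - 1) * (k - 1)" using True by (intro mult_right_mono) auto
    finally show ?thesis .
  qed (simp add: h_def)
  ultimately show False using assms(2) by linarith
qed

text \<open>The right-hand side k is (n - 1) / (q - 1) rounded up. Thus n \<le> k (q - 1) + 1, and
  replacing the 1 by k gives n \<le> k q.\<close>

lemma ratio_le_div: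
  assumes "n \<ge> 2" "q \<ge> 2"
  shows "real n / real q \<le> real ((n - 2) div (q - 1) + 1)"
proof -
  define k where "k = (n - 2) div (q - 1) + 1"
  have "n - 2 < k * (q - 1)"
    using assms dividend_less_div_times[of "q - 1" "n - 2"]
    unfolding k_def by (simp add: add.commute distrib_right)
  then have "n \<le> k * (q - 1) + 1" by linarith
  moreover have "1 \<le> k" by (simp add: k_def)
  ultimately have "n \<le> k * (q - 1) + k" by linarith
  also have "\<dots> = k * q" using assms by (cases q) auto
  finally have "real n \<le> real k * real q" by (metis of_nat_le_iff of_nat_mult)
  then show ?thesis using assms unfolding k_def[symmetric] by (simp add: divide_le_eq)
qed

theorem theorem8:
  fixes n q :: nat
  assumes "n \<ge> 2" and "q \<ge> 2"
  shows "(real n / real q) ^ (q - 1) \<le> real (walk_ramsey q n) \<and> walk_ramsey q n \<le> (n - 1) ^ (q - 1) + 1"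
proof
  \<comment> \<open>The largest k with (q - 1)(k - 1) \<le> n - 2, as the lower bound construction
    requires.\<close>
  define k where "k = (n - 2) div (q - 1) + 1"
  have forces: "forces_mono_walk q n ((n - 1) ^ (q - 1) + 1)"
    using assms by (intro forces_mono_walk_power) auto
  then show "walk_ramsey q n \<le> (n - 1) ^ (q - 1) + 1"
    unfolding walk_ramsey_def by (rule Least_le)
  have "(q - 1) * (k - 1) + 2 \<le> n"
    unfolding k_def add_diff_cancel_right'
    using assms(1) times_div_less_eq_dividend[of "q - 1" "n - 2"] by linarith
  \<comment> \<open>The construction covers every N up to k^(q - 1), so it can be applied at the
    least forcing N itself; \<open>forces\<close> ensures that this minimum is attained.\<close>
  then have "\<not> walk_ramsey q n \<le> k ^ (q - 1)"
    using not_forces_mono_walk[of "walk_ramsey q n" k q n] LeastI[of "forces_mono_walk q n", OF forces]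
      assms by (auto simp: walk_ramsey_def)
  moreover have "(real n / real q) ^ (q - 1) \<le> real k ^ (q - 1)"
    using ratio_le_div[OF assms] by (intro power_mono) (auto simp: k_def)
  ultimately show "(real n / real q) ^ (q - 1) \<le> real (walk_ramsey q n)"
    by (metis linorder_le_cases of_nat_le_iff of_nat_power order_trans)
qed

end
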